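(* There is a function $f\colon[0,1]_{\mathbb{Q}}\to\mathbb{R}$ such that: (1) $f$ is uniformly continuous on $[0,1]_{\mathbb{Q}}$; (2) $\lim_{a\to 1/\sqrt{2},\,a\in\mathbb{Q}\cap[0,1]} f(a)=1/\sqrt{2}$, and $1/\sqrt{2}>f(b)$ for every $b\in[0,1]_{\mathbb{Q}}$; (3) for every $a\in[0,1]_{\mathbb{Q}}$ the derivative $f'(a)=\lim_{b\to a,\ b\in[0,1]_{\mathbb{Q}},\ b\neq a}\frac{f(b)-f(a)}{b-a}$ exists and equals $1$.
   Context: For reals $u\le v$, $[u,v]_{\mathbb{Q}}=\{a\in\mathbb{Q}\mid u\le a\le v\}$. A function $f\colon M\to\mathbb{R}$ with $M\subset\mathbb{Q}$ is uniformly continuous if for every $k\in\mathbb{N}$ there is $l\in\mathbb{N}$ such that $a,b\in M$, $|a-b|\le 1/l$ imply $|f(a)-f(b)|\le 1/k$. For such a uniformly continuous $f$ and a real $x$ in the closure of $M$, the limit $\lim_{a\to x,a\in M}f(a)$ exists and is unique; it is denoted $f(x)$, so (2) says $f(1/\sqrt2)=1/\sqrt2$ for this extended value. *)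

theory Defs imports Complex_Main begin

definition rat_interval :: "real \<Rightarrow> real \<Rightarrow> real set" where
  "rat_interval u v = {a \<in> \<rat>. u \<le> a \<and> a \<le> v}"

end

theory Submission imports Defs "HOL-Analysis.Analysis" begin

text \<open>
  Put \<open>c = 1 / sqrt 2\<close>. Since \<open>c\<close> is irrational, the rationals can be covered by an open set \<open>U\<close>
  so small that it occupies less than half of \<open>[c, x]\<close> for every \<open>x > c\<close>. The function
  \<open>g x = |[c, x] - U|\<close> (Lebesgue measure) is 1-Lipschitz and locally constant at every rational,
  and \<open>2 * g x > x - c\<close> for \<open>x > c\<close>. Hence \<open>f x = x - 2 * g x\<close> is Lipschitz with \<open>f c = c\<close>, has
  slope 1 at every rational, and stays below \<open>c\<close> on both sides of \<open>c\<close>.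
\<close>

lemma sqrt_2_irrational: "sqrt 2 \<notin> \<rat>"
proof
  assume "sqrt 2 \<in> \<rat>"
  then obtain m n :: nat
    where n: "n \<noteq> 0" and mn: "\<bar>sqrt 2\<bar> = m / n" and cop: "coprime m n"
    by (rule Rats_abs_nat_div_natE)
  have "real m = sqrt 2 * n"
    using n mn by simp
  then have "real (m\<^sup>2) = real (2 * n\<^sup>2)"
    by (simp add: power_mult_distrib)
  then have eq: "m\<^sup>2 = 2 * n\<^sup>2"
    by (simp only: of_nat_eq_iff)
  then have "even (m\<^sup>2)"
    by simp
  then have "even m"
    by simp
  then obtain k where "m = 2 * k" ..
  with eq have "n\<^sup>2 = 2 * k\<^sup>2"
    by (simp add: power2_eq_square)
  then have "even (n\<^sup>2)"
    by simp
  then have "even n"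
    by simp
  with \<open>even m\<close> cop show False
    by (metis coprime_common_divisor_nat dvd_refl odd_one)
qed

text \<open>Around the n-th rational goes an interval whose radius is a small multiple of its
  distance to \<open>c\<close>. Such an interval reaches \<open>[c, x]\<close> only if its centre
  lies right of \<open>c\<close> at a distance comparable to \<open>x - c\<close>, so its length is
  bounded by a geometric term times \<open>x - c\<close>, and these terms sum to
  \<open>(x - c) / 3\<close>.\<close>

lemma open_cover_Rats_sparse_right:
  fixes c :: real
  assumes "c \<notin> \<rat>"
  obtains U where "open U" "\<rat> \<subseteq> U"
    and "\<And>x. c < x \<Longrightarrow> emeasure lborel ({c..x} \<inter> U) \<le> ennreal ((x - c) / 3)"
proof -
  define q :: "nat \<Rightarrow> real" where "q = from_nat_into \<rat>"
  have q_range: "range q = \<rat>"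
    unfolding q_def by (rule range_from_nat_into) (auto simp: countable_rat intro: Rats_0)
  then have q_ne: "q n \<noteq> c" for n
    using assms by (metis rangeI)
  \<comment> \<open>The factor 16 keeps \<open>I n\<close> well away from \<open>c\<close>; the
    factor \<open>2 ^ n\<close> makes the lengths summable.\<close>
  define r where "r n = \<bar>q n - c\<bar> / (16 * 2 ^ n)" for n
  define I where "I n = {q n - r n<..<q n + r n}" for n
  have r_pos: "0 < r n" for n
    using q_ne[of n] by (simp add: r_def)
  have I_small: "emeasure lborel ({c..x} \<inter> I n) \<le> ennreal ((x - c) / 3 * (1/2) ^ Suc n)"
    if "c < x" for x n
  proof (cases "{c..x} \<inter> I n = {}")
    case True
    then show ?thesis by simp
  next
    case False
    then have meet: "q n - r n < x" "c < q n + r n"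
      by (auto simp: I_def)
    have "16 * 1 \<le> 16 * (2::real) ^ n"
      by simp
    then have r16: "r n \<le> \<bar>q n - c\<bar> / 16"
      unfolding r_def by (intro divide_left_mono) auto
    \<comment> \<open>A centre left of \<open>c\<close> is excluded: its interval would end before
      \<open>c\<close>.\<close>
    with meet have "c < q n"
      by (auto simp: abs_if split: if_splits)
    \<comment> \<open>From \<open>q n - r n < x\<close> it follows that 15/16 of
      \<open>q n - c\<close> is less than \<open>x - c\<close>.\<close>
    with meet r16 have "q n - c \<le> 16 / 15 * (x - c)"
      by simp
    then have "(q n - c) / (8 * 2 ^ n) \<le> (16 / 15 * (x - c)) / (8 * 2 ^ n)"
      by (intro divide_right_mono) auto
    \<comment> \<open>Numerically, 16/15 * 1/8 = 2/15 \<le> 1/6.\<close>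
    also have "\<dots> \<le> (x - c) / 3 * (1/2) ^ Suc n"
      using that by (simp add: field_simps)
    finally have "(q n - c) / (8 * 2 ^ n) \<le> (x - c) / 3 * (1/2) ^ Suc n" .
    moreover have "2 * r n = (q n - c) / (8 * 2 ^ n)"
      using \<open>c < q n\<close> by (simp add: r_def field_simps)
    ultimately have len: "2 * r n \<le> (x - c) / 3 * (1/2) ^ Suc n"
      by (simp only:)
    have "emeasure lborel ({c..x} \<inter> I n) \<le> emeasure lborel (I n)"
      by (intro emeasure_mono) (auto simp: I_def)
    also have "\<dots> = ennreal (2 * r n)"
      using r_pos[of n] by (simp add: I_def)
    also have "\<dots> \<le> ennreal ((x - c) / 3 * (1/2) ^ Suc n)"
      using len by (rule ennreal_leI)
    finally show ?thesis .
  qed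
  show thesis
  proof
    show "open (\<Union>n. I n)"
      by (auto simp: I_def)
    show "\<rat> \<subseteq> (\<Union>n. I n)"
    proof
      fix a :: real
      assume "a \<in> \<rat>"
      then obtain n where "a = q n"
        using q_range by (metis rangeE)
      then show "a \<in> (\<Union>n. I n)"
        using r_pos[of n] by (intro UN_I[of n]) (auto simp: I_def)
    qed
    fix x
    assume "c < x"
    have sums: "(\<lambda>n. (x - c) / 3 * (1/2) ^ Suc n) sums ((x - c) / 3 * 1)"
      by (intro sums_mult power_half_series)
    have "emeasure lborel ({c..x} \<inter> (\<Union>n. I n)) = emeasure lborel (\<Union>n. {c..x} \<inter> I n)"
      by (simp only: Int_UN_distrib)
    also have "\<dots> \<le> (\<Sum>n. emeasure lborel ({c..x} \<inter> I n))"
      by (intro emeasure_subadditive_countably) (auto simp: I_def)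
    also have "\<dots> \<le> (\<Sum>n. ennreal ((x - c) / 3 * (1/2) ^ Suc n))"
      using I_small[OF \<open>c < x\<close>] by (intro suminf_le) auto
    also have "\<dots> = ennreal ((x - c) / 3)"
      using sums \<open>c < x\<close> by (subst suminf_ennreal_eq[OF _ sums]) auto
    finally show "emeasure lborel ({c..x} \<inter> (\<Union>n. I n)) \<le> ennreal ((x - c) / 3)" .
  qed
qed

text \<open>Moving the endpoint of \<open>[c, x]\<close> inside \<open>U\<close> does not change
  \<open>[c, x] - U\<close>, and \<open>U\<close> contains a ball around each rational. Since
  \<open>U\<close> fills at most a third of \<open>[c, x]\<close>, more than half of the length
  remains.\<close>

lemma exists_locally_constant_at_Rats:
  fixes c :: real
  assumes "c \<notin> \<rat>"
  obtains g :: "real \<Rightarrow> real"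
  where "1-lipschitz_on UNIV g"
    and "\<And>a. a \<in> \<rat> \<Longrightarrow> \<forall>\<^sub>F b in nhds a. g b = g a"
    and "\<And>x. x \<le> c \<Longrightarrow> g x = 0"
    and "\<And>x. c < x \<Longrightarrow> x - c < 2 * g x"
proof -
  obtain U where U: "open U" "\<rat> \<subseteq> U"
    and U_small: "\<And>x. c < x \<Longrightarrow> emeasure lborel ({c..x} \<inter> U) \<le> ennreal ((x - c) / 3)"
    using open_cover_Rats_sparse_right[OF assms] by blast
  have [measurable]: "U \<in> sets borel"
    using U(1) by simp
  define g where "g x = measure lborel ({c..x} - U)" for x
  have Icc: "{a..b} \<in> fmeasurable lborel" for a b :: real
    by (simp add: fmeasurable_def emeasure_lborel_Icc_eq)
  have fm: "{a..b} - U \<in> fmeasurable lborel" for a b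
    by (rule fmeasurableI2[OF Icc]) auto
  have mono: "g x \<le> g y" if "x \<le> y" for x y
    unfolding g_def using that by (intro measure_mono_fmeasurable fm) auto
  have step: "g y \<le> g x + (y - x)" if "x \<le> y" for x y
  proof -
    \<comment> \<open>The inclusion of \<open>{c..y}\<close> in
      \<open>{c..x} \<union> {x..y}\<close> also covers \<open>x < c\<close>, where
      \<open>{c..x}\<close> is empty.\<close>
    have "g y \<le> measure lborel (({c..x} - U) \<union> {x..y})"
      unfolding g_def by (intro measure_mono_fmeasurable fmeasurable.Un fm Icc) auto
    also have "\<dots> \<le> measure lborel ({c..x} - U) + measure lborel {x..y}"
      by (intro measure_Un_le) auto
    finally show ?thesis
      using that by (simp add: g_def)
  qed
  show thesis
  proof
    show "1-lipschitz_on UNIV g"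
    proof (rule lipschitz_onI)
      show "dist (g x) (g y) \<le> 1 * dist x y" for x y
        using mono[of x y] mono[of y x] step[of x y] step[of y x]
        by (cases "x \<le> y") (auto simp: dist_real_def)
    qed simp
    show "\<forall>\<^sub>F b in nhds a. g b = g a" if "a \<in> \<rat>" for a
    proof -
      obtain e where e: "0 < e" "ball a e \<subseteq> U"
        using U \<open>a \<in> \<rat>\<close> by (meson open_contains_ball subsetD)
      have "g b = g a" if "dist b a < e" for b
      proof -
        \<comment> \<open>The segment between \<open>a\<close> and \<open>b\<close> lies in the
          ball, so no point outside \<open>U\<close> separates them.\<close>
        have "t \<in> U" if "min a b \<le> t" "t \<le> max a b" for t
          using that \<open>dist b a < e\<close> by (intro subsetD[OF e(2)]) (auto simp: dist_real_def)
        then have "t \<le> b \<longleftrightarrow> t \<le> a" if "t \<notin> U" for t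
          using that by (metis linear max.coboundedI1 max.coboundedI2 min.coboundedI1 min.coboundedI2)
        then have "{c..b} - U = {c..a} - U"
          by auto
        then show ?thesis
          by (simp add: g_def)
      qed
      then show ?thesis
        using e(1) unfolding eventually_nhds_metric by (intro exI[of _ e] conjI allI impI)
    qed
    show "g x = 0" if "x \<le> c" for x
    proof -
      \<comment> \<open>For \<open>x \<le> c\<close> the interval \<open>{c..x}\<close> is empty or
        the null set \<open>{c}\<close>.\<close>
      have "g x \<le> measure lborel {c..c}"
        unfolding g_def using that by (intro measure_mono_fmeasurable Icc) auto
      then show ?thesis
        by (simp add: g_def measure_le_0_iff)
    qed
    show "x - c < 2 * g x" if "c < x" for x
    proof -
      have "measure lborel ({c..x} \<inter> U) \<le> (x - c) / 3"
        unfolding measure_def using U_small[OF that] that by (intro enn2real_leI) auto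
      moreover have "measure lborel {c..x} \<le> g x + measure lborel ({c..x} \<inter> U)"
        unfolding g_def using measure_Un_le[of "{c..x} - U" lborel "{c..x} \<inter> U"]
        by (simp add: Un_Diff_Int)
      ultimately show ?thesis
        using that by simp
    qed
  qed
qed

theorem theorem6p1:
  "\<exists>f :: real \<Rightarrow> real.
     uniformly_continuous_on (rat_interval 0 1) f \<and>
     (f \<longlongrightarrow> 1 / sqrt 2) (at (1 / sqrt 2) within rat_interval 0 1) \<and>
     (\<forall>b \<in> rat_interval 0 1. 1 / sqrt 2 > f b) \<and>
     (\<forall>a \<in> rat_interval 0 1.
        ((\<lambda>b. (f b - f a) / (b - a)) \<longlongrightarrow> 1) (at a within rat_interval 0 1))"
proof -
  define c :: real where "c = 1 / sqrt 2"
  have c_irr: "c \<notin> \<rat>"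
  proof
    assume "c \<in> \<rat>"
    then have "inverse c \<in> \<rat>"
      by (rule Rats_inverse)
    then show False
      using sqrt_2_irrational by (simp add: c_def)
  qed
  obtain g :: "real \<Rightarrow> real"
    where lip: "1-lipschitz_on UNIV g"
      and const: "\<And>a. a \<in> \<rat> \<Longrightarrow> \<forall>\<^sub>F b in nhds a. g b = g a"
      and left: "\<And>x. x \<le> c \<Longrightarrow> g x = 0"
      and right: "\<And>x. c < x \<Longrightarrow> x - c < 2 * g x"
    using exists_locally_constant_at_Rats[OF c_irr] by blast
  \<comment> \<open>The factor 2 turns \<open>x - c < 2 * g x\<close> into
    \<open>f x < c\<close>.\<close>
  define f where "f x = x - 2 * g x" for x
  have g_uc: "uniformly_continuous_on UNIV g"
    using lip by (rule lipschitz_on_uniformly_continuous)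
  have f_uc: "uniformly_continuous_on UNIV f"
    unfolding f_def using g_uc
    by (intro uniformly_continuous_on_diff uniformly_continuous_on_id
        uniformly_continuous_on_cmul_left)
  have "isCont f c"
    using uniformly_continuous_imp_continuous[OF f_uc] by (simp add: continuous_on_eq_continuous_at)
  then have lim: "(f \<longlongrightarrow> c) (at c within S)" for S
    using left[of c] by (auto simp: isCont_def f_def intro: tendsto_within_subset)
  \<comment> \<open>Strictness fails at \<open>c\<close> itself, where \<open>f c = c\<close>;
    rationality of \<open>b\<close> rules this point out.\<close>
  have below: "f b < c" if "b \<in> \<rat>" for b
  proof (cases "b < c")
    case True
    then show ?thesis
      using left[of b] by (simp add: f_def)
  next
    case False
    then have "c < b"
      using that c_irr by (metis linorder_neqE)
    then show ?thesis
      using right[of b] by (simp add: f_def)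
  qed
  have deriv: "((\<lambda>b. (f b - f a) / (b - a)) \<longlongrightarrow> 1) (at a within S)" if "a \<in> \<rat>" for a S
  proof (rule tendsto_eventually)
    \<comment> \<open>Near a rational the \<open>g\<close> terms cancel, so the difference quotient
      is exactly 1.\<close>
    have "\<forall>\<^sub>F b in at a within S. g b = g a"
      using const[OF that] by (auto simp: eventually_at_filter elim: eventually_mono)
    moreover have "\<forall>\<^sub>F b in at a within S. b \<noteq> a"
      by (simp add: eventually_at_filter)
    ultimately show "\<forall>\<^sub>F b in at a within S. (f b - f a) / (b - a) = 1"
      by eventually_elim (simp add: f_def)
  qed
  have "rat_interval 0 1 \<subseteq> \<rat>"
    by (auto simp: rat_interval_def)
  moreover have "uniformly_continuous_on (rat_interval 0 1) f"
    using f_uc unfolding uniformly_continuous_on_def by blast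
  ultimately show ?thesis
    using lim below deriv unfolding c_def
    by (intro exI[of _ f] conjI ballI) (simp_all add: subset_iff)
qed

end
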